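(* Let $q\ge 1$ be an integer and let $T$ be an infinite $(q+1)$-homogeneous tree rooted at $o$. Let $1\le p\le\infty$, let $X$ be $\mathbb{T}_p$ or $\mathbb{T}_{p,0}$ with norm $\|\cdot\|_p$, and let $M_\psi$ be a bounded multiplication operator on $X$, where $\psi\colon T\to\mathbb{C}$. Then $$\|M_\psi\|_e\le\limsup_{n\to\infty}M_\infty(n,\psi)=\lim_{n\to\infty}\sup_{|v|\ge n}|\psi(v)|.$$
   Context: A $(q+1)$-homogeneous tree is a connected graph without cycles in which every vertex has exactly $q+1$ neighbours; rooted means that a vertex $o$ (the root) is singled out. For a vertex $v$, $|v|$ is the number of edges in the unique path from $o$ to $v$; for $n\ge1$ there are $(q+1)q^{n-1}$ vertices with $|v|=n$. Functions on $T$ are functions on its vertices. $\mathbb{N}=\{1,2,\dots\}$, $\mathbb{N}_0=\mathbb{N}\cup\{0\}$. For $f\colon T\to\mathbb{C}$ and $n\in\mathbb{N}$, $M_p(n,f)=\left(\frac{1}{(q+1)q^{n-1}}\sum_{|v|=n}|f(v)|^p\right)^{1/p}$ if $0<p<\infty$, $M_\infty(n,f)=\max_{|v|=n}|f(v)|$, and $M_p(0,f)=|f(o)|$ for all $p\in(0,\infty]$. Put $\|f\|_p=\sup_{n\in\mathbb{N}_0}M_p(n,f)$, $\mathbb{T}_p=\{f\colon T\to\mathbb{C}:\|f\|_p<\infty\}$ and $\mathbb{T}_{p,0}=\{f\in\mathbb{T}_p:\lim_{n\to\infty}M_p(n,f)=0\}$. For $1\le p\le\infty$ these are Banach spaces under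 $\|\cdot\|_p$. The multiplication operator with symbol $\psi$ is $M_\psi f=\psi f$ (pointwise product). The essential norm of a bounded operator $A$ on $X$ is $\|A\|_e=\inf\{\|A-K\|:K\text{ a compact operator on }X\}$, with $\|\cdot\|$ the operator norm. *)

theory Defs
  imports "HOL-Analysis.Analysis"
begin

text \<open>
  A simple graph is given by its adjacency relation; its vertex set is the whole type \<open>'v\<close>, so
  functions on the vertices are exactly the functions of type \<open>'v \<Rightarrow> complex\<close>.
\<close>

definition simple_graph :: "('v \<Rightarrow> 'v \<Rightarrow> bool) \<Rightarrow> bool" where
  "simple_graph E \<longleftrightarrow> (\<forall>u v. E u v \<longrightarrow> E v u) \<and> (\<forall>v. \<not> E v v)"

definition graph_path :: "('v \<Rightarrow> 'v \<Rightarrow> bool) \<Rightarrow> 'v \<Rightarrow> 'v list \<Rightarrow> 'v \<Rightarrow> bool" where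
  "graph_path E u xs v \<longleftrightarrow>
     xs \<noteq> [] \<and> hd xs = u \<and> last xs = v \<and> distinct xs \<and> successively E xs"

definition graph_cycle :: "('v \<Rightarrow> 'v \<Rightarrow> bool) \<Rightarrow> 'v list \<Rightarrow> bool" where
  "graph_cycle E xs \<longleftrightarrow>
     length xs \<ge> 3 \<and> distinct xs \<and> successively E xs \<and> E (last xs) (hd xs)"

definition homogeneous_tree :: "('v \<Rightarrow> 'v \<Rightarrow> bool) \<Rightarrow> nat \<Rightarrow> bool" where
  "homogeneous_tree E d \<longleftrightarrow>
     simple_graph E \<and>
     (\<forall>u v. \<exists>xs. graph_path E u xs v) \<and>
     (\<nexists>xs. graph_cycle E xs) \<and>
     (\<forall>v. finite {w. E v w} \<and> card {w. E v w} = d)"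

definition level :: "('v \<Rightarrow> 'v \<Rightarrow> bool) \<Rightarrow> 'v \<Rightarrow> 'v \<Rightarrow> nat" where
  "level E rt v = length (THE xs. graph_path E rt xs v) - 1"

definition sphere_mean ::
    "('v \<Rightarrow> 'v \<Rightarrow> bool) \<Rightarrow> nat \<Rightarrow> 'v \<Rightarrow> ereal \<Rightarrow> nat \<Rightarrow> ('v \<Rightarrow> complex) \<Rightarrow> real" where
  "sphere_mean E q rt p n f =
     (if n = 0 then cmod (f rt)
      else if p = \<infinity> then Max ((\<lambda>v. cmod (f v)) ` {v. level E rt v = n})
      else ((1 / ((real q + 1) * real q ^ (n - 1))) *
             (\<Sum>v | level E rt v = n. cmod (f v) powr real_of_ereal p)) powr (1 / real_of_ereal p))"

text \<open>The value of \<open>hardy_norm\<close> is meaningful only for functions in \<open>hardy_space\<close>.\<close>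

definition hardy_norm ::
    "('v \<Rightarrow> 'v \<Rightarrow> bool) \<Rightarrow> nat \<Rightarrow> 'v \<Rightarrow> ereal \<Rightarrow> ('v \<Rightarrow> complex) \<Rightarrow> real" where
  "hardy_norm E q rt p f = (SUP n. sphere_mean E q rt p n f)"

definition hardy_space ::
    "('v \<Rightarrow> 'v \<Rightarrow> bool) \<Rightarrow> nat \<Rightarrow> 'v \<Rightarrow> ereal \<Rightarrow> ('v \<Rightarrow> complex) set" where
  "hardy_space E q rt p = {f. bdd_above (range (\<lambda>n. sphere_mean E q rt p n f))}"

definition hardy_space0 ::
    "('v \<Rightarrow> 'v \<Rightarrow> bool) \<Rightarrow> nat \<Rightarrow> 'v \<Rightarrow> ereal \<Rightarrow> ('v \<Rightarrow> complex) set" where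
  "hardy_space0 E q rt p =
     {f \<in> hardy_space E q rt p. (\<lambda>n. sphere_mean E q rt p n f) \<longlonglongrightarrow> 0}"

text \<open>
  A normed space of functions is a set \<open>X\<close> of functions with a norm \<open>N\<close> that is used on \<open>X\<close> only.
  An operator on \<open>X\<close> is a function on all of \<open>'v \<Rightarrow> complex\<close>, whose values outside \<open>X\<close> are irrelevant.
\<close>

definition linear_operator ::
    "('v \<Rightarrow> complex) set \<Rightarrow> (('v \<Rightarrow> complex) \<Rightarrow> ('v \<Rightarrow> complex)) \<Rightarrow> bool" where
  "linear_operator X A \<longleftrightarrow>
     (\<forall>f\<in>X. A f \<in> X) \<and>
     (\<forall>f\<in>X. \<forall>g\<in>X. A (\<lambda>v. f v + g v) = (\<lambda>v. A f v + A g v)) \<and>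
     (\<forall>c. \<forall>f\<in>X. A (\<lambda>v. c * f v) = (\<lambda>v. c * A f v))"

definition bounded_operator ::
    "('v \<Rightarrow> complex) set \<Rightarrow> (('v \<Rightarrow> complex) \<Rightarrow> real) \<Rightarrow>
     (('v \<Rightarrow> complex) \<Rightarrow> ('v \<Rightarrow> complex)) \<Rightarrow> bool" where
  "bounded_operator X N A \<longleftrightarrow>
     linear_operator X A \<and> (\<exists>C. \<forall>f\<in>X. N (A f) \<le> C * N f)"

text \<open>
  The locale \<open>Metric_space\<close> demands nonnegativity and symmetry of the distance for arbitrary
  arguments, not only for points of the space; hence the default value outside \<open>X\<close>.
\<close>

definition norm_dist ::
    "('v \<Rightarrow> complex) set \<Rightarrow> (('v \<Rightarrow> complex) \<Rightarrow> real) \<Rightarrow>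
     ('v \<Rightarrow> complex) \<Rightarrow> ('v \<Rightarrow> complex) \<Rightarrow> real" where
  "norm_dist X N f g = (if f \<in> X \<and> g \<in> X then N (\<lambda>v. f v - g v) else 0)"

definition norm_topology ::
    "('v \<Rightarrow> complex) set \<Rightarrow> (('v \<Rightarrow> complex) \<Rightarrow> real) \<Rightarrow> ('v \<Rightarrow> complex) topology" where
  "norm_topology X N = Metric_space.mtopology X (norm_dist X N)"

definition compact_operator ::
    "('v \<Rightarrow> complex) set \<Rightarrow> (('v \<Rightarrow> complex) \<Rightarrow> real) \<Rightarrow>
     (('v \<Rightarrow> complex) \<Rightarrow> ('v \<Rightarrow> complex)) \<Rightarrow> bool" where
  "compact_operator X N K \<longleftrightarrow>
     linear_operator X K \<and>
     compactin (norm_topology X N) (norm_topology X N closure_of (K ` {f \<in> X. N f \<le> 1}))"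

text \<open>The supremum is a genuine one for bounded operators.\<close>

definition operator_norm ::
    "('v \<Rightarrow> complex) set \<Rightarrow> (('v \<Rightarrow> complex) \<Rightarrow> real) \<Rightarrow>
     (('v \<Rightarrow> complex) \<Rightarrow> ('v \<Rightarrow> complex)) \<Rightarrow> real" where
  "operator_norm X N A = (SUP f\<in>{f \<in> X. N f \<le> 1}. N (A f))"

definition essential_norm ::
    "('v \<Rightarrow> complex) set \<Rightarrow> (('v \<Rightarrow> complex) \<Rightarrow> real) \<Rightarrow>
     (('v \<Rightarrow> complex) \<Rightarrow> ('v \<Rightarrow> complex)) \<Rightarrow> real" where
  "essential_norm X N A =
     (INF K\<in>{K. compact_operator X N K}. operator_norm X N (\<lambda>f v. A f v - K f v))"

definition mult_operator :: "('v \<Rightarrow> complex) \<Rightarrow> ('v \<Rightarrow> complex) \<Rightarrow> ('v \<Rightarrow> complex)" where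
  "mult_operator \<psi> f = (\<lambda>v. \<psi> v * f v)"

end

theory Submission
  imports Defs
begin

text \<open>
  For each \<open>n\<close> the truncation of \<open>\<psi>\<close> to the finite set of vertices of level below \<open>n\<close> is the symbol of
  a finite-rank, hence compact, operator \<open>K\<close>, and \<open>M\<^sub>\<psi> - K\<close> multiplies by the remaining tail of \<open>\<psi>\<close>,
  so its norm is at most the supremum of \<open>\<bar>\<psi>\<bar>\<close> over the levels from \<open>n\<close> on. Letting \<open>n\<close> grow gives the
  bound. That \<open>M\<^sub>\<psi>\<close> and compact operators are bounded is needed because the suprema and infima are
  taken in the reals: it makes the values entering the infimum nonnegative.
\<close>

subsection \<open>Paths and spheres in a tree\<close>

text \<open>
  If two paths part at the start, following the first one to its first common vertex with the second
  and returning along the second closes a cycle.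
\<close>

lemma graph_path_unique:
  assumes sym: "\<And>u v. E u v \<Longrightarrow> E v u" and acyc: "\<nexists>xs. graph_cycle E xs"
    and "graph_path E u xs v" "graph_path E u ys v"
  shows "xs = ys"
  using assms(3,4)
proof (induction xs arbitrary: u ys)
  case Nil
  then show ?case by (simp add: graph_path_def)
next
  case (Cons w xs)
  have wu: "w = u" using Cons.prems by (simp add: graph_path_def)
  obtain zs where ys: "ys = u # zs"
    using Cons.prems(2) by (cases ys) (auto simp: graph_path_def)
  show ?case
  proof (cases "xs = [] \<or> zs = []")
    case True
    then show ?thesis
      using Cons.prems ys wu by (auto simp: graph_path_def split: if_splits)
  next
    case False
    have px: "graph_path E (hd xs) xs v" "E u (hd xs)" "u \<notin> set xs"
      using Cons.prems(1) False wu by (auto simp: graph_path_def successively_Cons)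
    have pz: "graph_path E (hd zs) zs v" "E u (hd zs)" "u \<notin> set zs"
      using Cons.prems(2) False ys by (auto simp: graph_path_def successively_Cons)
    have "hd xs = hd zs"
    proof (rule ccontr)
      assume ne: "hd xs \<noteq> hd zs"
      have "\<exists>x\<in>set xs. x \<in> set zs"
        using px(1) pz(1) by (metis graph_path_def last_in_set)
      then obtain a x b where xs: "xs = a @ x # b" and x: "x \<in> set zs"
        and a: "\<forall>y\<in>set a. y \<notin> set zs"
        using split_list_first_prop[of xs "\<lambda>x. x \<in> set zs"] by blast
      obtain c d where zs: "zs = c @ x # d"
        using split_list[OF x] by blast
      have "graph_cycle E (u # a @ x # rev c)"
        unfolding graph_cycle_def
      proof (intro conjI)
        \<comment> \<open>The lists \<open>a\<close> and \<open>c\<close> are not both empty: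
          otherwise \<open>x\<close> would be the head of both \<open>xs\<close> and
          \<open>zs\<close>, contrary to \<open>ne\<close>.\<close>
        show "3 \<le> length (u # a @ x # rev c)"
          using ne xs zs by (cases a; cases c) auto
        show "distinct (u # a @ x # rev c)"
          using px pz a xs zs by (auto simp: graph_path_def)
        have "successively (\<lambda>x y. E y x) c"
          using pz(1) zs sym by (auto simp: graph_path_def successively_append_iff intro: successively_mono)
        then have "successively E (x # rev c)"
          using pz(1) zs sym
          by (auto simp: graph_path_def successively_append_iff successively_Cons hd_rev)
        then show "successively E (u # a @ x # rev c)"
          using px xs by (cases a) (auto simp: graph_path_def successively_append_iff successively_Cons hd_append split: if_splits)
        \<comment> \<open>Whether or not \<open>c\<close> is empty, the last vertex is
          \<open>hd zs\<close>, a neighbour of \<open>u\<close>.\<close>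
        show "E (last (u # a @ x # rev c)) (hd (u # a @ x # rev c))"
          using sym[OF pz(2)] zs by (cases c) (auto simp: last_rev)
      qed
      with acyc show False by blast
    qed
    then show ?thesis using Cons.IH[of "hd xs" zs] px pz ys wu by simp
  qed
qed

locale rooted_tree =
  fixes E :: "'v \<Rightarrow> 'v \<Rightarrow> bool" and q :: nat and rt :: 'v
  assumes tree: "homogeneous_tree E (q + 1)"
    and infinite_vertices: "infinite (UNIV :: 'v set)"
    and q_pos: "q \<ge> 1"
begin

abbreviation "sphere_at n \<equiv> {v. level E rt v = n}"

lemma edge_sym: "E u v \<Longrightarrow> E v u"
  using tree by (auto simp: homogeneous_tree_def simple_graph_def)

lemma path_unique: "graph_path E u xs v \<Longrightarrow> graph_path E u ys v \<Longrightarrow> xs = ys"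
  using tree edge_sym graph_path_unique by (metis homogeneous_tree_def)

lemma level_path: "graph_path E rt xs v \<Longrightarrow> level E rt v = length xs - 1"
  unfolding level_def using path_unique by (metis the_equality)

lemma obtain_path:
  obtains xs where "graph_path E rt xs v" "length xs = Suc (level E rt v)"
proof -
  obtain xs where xs: "graph_path E rt xs v"
    using tree unfolding homogeneous_tree_def by blast
  moreover have "length xs > 0" using xs by (simp add: graph_path_def)
  ultimately show ?thesis using level_path[OF xs] that by simp
qed

lemma level_rt: "level E rt rt = 0"
  by (rule level_path[where xs = "[rt]", simplified]) (simp add: graph_path_def)

lemma sphere_at_0: "sphere_at 0 = {rt}"
proof -
  have "v = rt" if "level E rt v = 0" for v
    by (rule obtain_path[of v]) (use that in \<open>auto simp: graph_path_def length_Suc_conv\<close>)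
  then show ?thesis using level_rt by auto
qed

text \<open>Induction on the length: a walk with one more vertex arises from a shorter walk by
  appending one of the finitely many neighbours of its last vertex.\<close>

lemma finite_paths: "finite {xs. length xs = Suc n \<and> hd xs = rt \<and> successively E xs}"
proof (induction n)
  case 0
  have "{xs. length xs = Suc 0 \<and> hd xs = rt \<and> successively E xs} \<subseteq> {[rt]}"
    by (auto simp: length_Suc_conv)
  then show ?case by (rule finite_subset) simp
next
  case (Suc n)
  let ?P = "\<lambda>n. {xs. length xs = Suc n \<and> hd xs = rt \<and> successively E xs}"
  have "?P (Suc n) \<subseteq> (\<Union>xs\<in>?P n. (\<lambda>w. xs @ [w]) ` {w. E (last xs) w})"
  proof
    fix xs assume xs: "xs \<in> ?P (Suc n)"
    then obtain ys w where "xs = ys @ [w]" "length ys = Suc n"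
      by (cases xs rule: rev_cases) auto
    moreover from this have "ys \<noteq> []" by auto
    ultimately show "xs \<in> (\<Union>xs\<in>?P n. (\<lambda>w. xs @ [w]) ` {w. E (last xs) w})"
      using xs by (intro UN_I[of ys]) (auto simp: successively_append_iff)
  qed
  moreover have "finite {w. E v w}" for v
    using tree by (simp add: homogeneous_tree_def)
  ultimately show ?case
    using Suc by (elim finite_subset) (intro finite_UN_I finite_imageI)
qed

lemma finite_sphere_at: "finite (sphere_at n)"
proof (rule finite_subset)
  show "sphere_at n \<subseteq> last ` {xs. length xs = Suc n \<and> hd xs = rt \<and> successively E xs}"
  proof
    fix v assume "v \<in> sphere_at n"
    then show "v \<in> last ` {xs. length xs = Suc n \<and> hd xs = rt \<and> successively E xs}"
      by (rule_tac obtain_path[of v]) (auto simp: graph_path_def)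
  qed
qed (simp add: finite_paths)

lemma finite_ball_at: "finite {v. level E rt v < n}"
proof -
  have "{v. level E rt v < n} = (\<Union>k<n. sphere_at k)" by auto
  then show ?thesis using finite_sphere_at by simp
qed

text \<open>Balls are finite and the tree is infinite, so some vertex has level at least
  \<open>n\<close>; the prefix with \<open>n + 1\<close> vertices of its path from the root ends at
  level \<open>n\<close>. This makes \<open>Max\<close> over a sphere meaningful.\<close>

lemma sphere_at_nonempty: "sphere_at n \<noteq> {}"
proof -
  have "\<exists>v. \<not> level E rt v < n"
    using finite_ball_at[of n] infinite_vertices by (metis (full_types) UNIV_eq_I mem_Collect_eq)
  then obtain v where v: "level E rt v \<ge> n" by (auto simp: linorder_not_less)
  obtain xs where xs: "graph_path E rt xs v" "length xs = Suc (level E rt v)"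
    by (rule obtain_path)
  let ?ys = "take (Suc n) xs"
  have "graph_path E rt ?ys (last ?ys)"
    using xs successively_append_iff[of E ?ys "drop (Suc n) xs"]
    by (simp add: graph_path_def hd_take)
  from level_path[OF this] have "level E rt (last ?ys) = n" using xs v by simp
  then show ?thesis by blast
qed

end

subsection \<open>The sphere means are seminorms\<close>

text \<open>Convexity of the r-th power on the closed half-line. At the boundary, where
  \<open>x\<close> or \<open>y\<close> is 0, it reduces to \<open>s powr r \<le> s\<close> for
  \<open>s\<close> in the unit interval.\<close>

lemma powr_convex_nonneg:
  assumes "r \<ge> 1" "0 \<le> x" "0 \<le> y" "0 \<le> s" "0 \<le> t" "s + t = (1::real)"
  shows "(s * x + t * y) powr r \<le> s * x powr r + t * y powr r"
proof -
  have le: "s powr r \<le> s" if "0 \<le> s" "s \<le> 1" for s :: real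
    using powr_mono'[of 1 r s] that assms(1) by (cases "s = 0") auto
  consider "x = 0" | "y = 0" | "x > 0" "y > 0" using assms by linarith
  then show ?thesis
  proof cases
    case 1
    then show ?thesis
      using le[of t] assms by (auto simp: powr_mult intro: mult_right_mono)
  next
    case 2
    then show ?thesis
      using le[of s] assms by (auto simp: powr_mult intro: mult_right_mono)
  next
    case 3
    have s: "s = 1 - t" using assms by simp
    show ?thesis
      using convex_onD[OF powr_convex[OF assms(1)], of t x y] assms 3 unfolding s by simp
  qed
qed

text \<open>Normalisation: \<open>(a v + b v) / (\<alpha> + \<beta>)\<close> is the convex
  combination, with weights \<open>s\<close> and \<open>t\<close>, of \<open>a v / \<alpha>\<close>
  and \<open>b v / \<beta>\<close>. For both of these the weighted sum of r-th powers is at most 1,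
  and convexity passes this bound on to the combination.\<close>

lemma weighted_Minkowski:
  fixes a b :: "'a \<Rightarrow> real"
  assumes r: "r \<ge> 1" and w: "w \<ge> 0"
    and ab: "\<And>v. 0 \<le> a v" "\<And>v. 0 \<le> b v"
  shows "(w * (\<Sum>v\<in>S. (a v + b v) powr r)) powr (1/r)
         \<le> (w * (\<Sum>v\<in>S. a v powr r)) powr (1/r) + (w * (\<Sum>v\<in>S. b v powr r)) powr (1/r)"
    (is "?N \<le> ?A + ?B")
proof -
  \<comment> \<open>The strict inequalities make \<alpha> and \<beta> positive even if
    \<open>?A\<close> or \<open>?B\<close> vanishes, so that dividing by them is safe; the epsilon
    argument at the end removes the strictness.\<close>
  have key: "?N \<le> \<alpha> + \<beta>" if \<alpha>: "\<alpha> > ?A" and \<beta>: "\<beta> > ?B" for \<alpha> \<beta>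
  proof -
    have pos: "\<alpha> > 0" "\<beta> > 0"
      using \<alpha> \<beta> powr_ge_zero le_less_trans by blast+
    have bound: "w * (\<Sum>v\<in>S. (c v / \<gamma>) powr r) \<le> 1"
      if "\<gamma> > (w * (\<Sum>v\<in>S. c v powr r)) powr (1/r)" "\<gamma> > 0" "\<And>v. 0 \<le> c v" for c :: "'a \<Rightarrow> real" and \<gamma>
    proof -
      have nn: "0 \<le> w * (\<Sum>v\<in>S. c v powr r)" using w by (intro mult_nonneg_nonneg sum_nonneg) auto
      have "((w * (\<Sum>v\<in>S. c v powr r)) powr (1/r)) powr r \<le> \<gamma> powr r"
        using that r by (intro powr_mono2) auto
      then have "w * (\<Sum>v\<in>S. c v powr r) \<le> \<gamma> powr r"
        using nn r by (simp add: powr_powr)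
      then show ?thesis
        using that r by (simp add: powr_divide divide_le_eq flip: sum_divide_distrib)
    qed
    define s where "s = \<alpha> / (\<alpha> + \<beta>)"
    define t where "t = \<beta> / (\<alpha> + \<beta>)"
    have "s + t = (\<alpha> + \<beta>) / (\<alpha> + \<beta>)"
      unfolding s_def t_def by (rule add_divide_distrib[symmetric])
    then have st: "0 \<le> s" "0 \<le> t" "s + t = 1"
      using pos by (simp_all add: s_def t_def)
    have "w * (\<Sum>v\<in>S. ((a v + b v) / (\<alpha> + \<beta>)) powr r)
          \<le> w * (\<Sum>v\<in>S. s * (a v / \<alpha>) powr r + t * (b v / \<beta>) powr r)"
    proof (intro mult_left_mono sum_mono w)
      fix v
      have "(a v + b v) / (\<alpha> + \<beta>) = s * (a v / \<alpha>) + t * (b v / \<beta>)"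
        using pos by (simp add: s_def t_def add_divide_distrib)
      then show "((a v + b v) / (\<alpha> + \<beta>)) powr r \<le> s * (a v / \<alpha>) powr r + t * (b v / \<beta>) powr r"
        using powr_convex_nonneg[OF r _ _ st, of "a v / \<alpha>" "b v / \<beta>"] ab pos by simp
    qed
    also have "\<dots> = s * (w * (\<Sum>v\<in>S. (a v / \<alpha>) powr r)) + t * (w * (\<Sum>v\<in>S. (b v / \<beta>) powr r))"
      by (simp add: sum.distrib algebra_simps flip: sum_distrib_left)
    also have "\<dots> \<le> s * 1 + t * 1"
      using bound[OF \<alpha> pos(1) ab(1)] bound[OF \<beta> pos(2) ab(2)] st
      by (intro add_mono mult_left_mono) auto
    finally have "w * (\<Sum>v\<in>S. (a v + b v) powr r) \<le> (\<alpha> + \<beta>) powr r"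
      using st pos ab by (simp add: powr_divide divide_le_eq flip: sum_divide_distrib)
    then have "?N \<le> ((\<alpha> + \<beta>) powr r) powr (1/r)"
      using w r by (intro powr_mono2) (auto intro!: mult_nonneg_nonneg sum_nonneg)
    then show ?thesis using pos r by (simp add: powr_powr)
  qed
  show ?thesis
  proof (rule field_le_epsilon)
    fix e :: real assume "e > 0"
    then show "?N \<le> ?A + ?B + e" using key[of "?A + e/2" "?B + e/2"] by simp
  qed
qed

locale hardy_tree = rooted_tree E q rt for E :: "'v \<Rightarrow> 'v \<Rightarrow> bool" and q rt +
  fixes p :: ereal
  assumes one_le_p: "1 \<le> p"
begin

abbreviation "M \<equiv> sphere_mean E q rt p"
abbreviation "N \<equiv> hardy_norm E q rt p"

lemma p_cases:
  obtains "p = \<infinity>" | r where "p = ereal r" "r \<ge> 1"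
  using one_le_p by (cases p) auto

lemma sphere_mean_nonneg: "0 \<le> M n f"
proof -
  obtain v where v: "v \<in> sphere_at n" using sphere_at_nonempty by blast
  have "0 \<le> cmod (f v)" by simp
  also have "\<dots> \<le> Max ((\<lambda>v. cmod (f v)) ` sphere_at n)"
    using v finite_sphere_at by (intro Max_ge) auto
  finally show ?thesis by (simp add: sphere_mean_def)
qed

text \<open>Monotonicity and homogeneity in one estimate, local to a single sphere. Later
  \<open>c = 0\<close> yields vanishing means, and \<open>c = 1 / cmod (f v)\<close> bounds point
  evaluations.\<close>

lemma sphere_mean_scale_mono:
  assumes c: "c \<ge> 0" and le: "\<And>v. level E rt v = n \<Longrightarrow> cmod (f v) \<le> c * cmod (g v)"
  shows "M n f \<le> c * M n g"
proof (cases "n = 0")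
  case True
  then show ?thesis using le[of rt] level_rt by (simp add: sphere_mean_def)
next
  case False
  show ?thesis
  proof (cases rule: p_cases)
    case 1
    have "Max ((\<lambda>v. cmod (f v)) ` sphere_at n) \<le> c * Max ((\<lambda>v. cmod (g v)) ` sphere_at n)"
    proof (rule Max.boundedI)
      fix a assume "a \<in> (\<lambda>v. cmod (f v)) ` sphere_at n"
      then obtain v where v: "level E rt v = n" "a = cmod (f v)" by auto
      have "cmod (g v) \<le> Max ((\<lambda>v. cmod (g v)) ` sphere_at n)"
        using v finite_sphere_at by (intro Max_ge) auto
      then show "a \<le> c * Max ((\<lambda>v. cmod (g v)) ` sphere_at n)"
        using le[OF v(1)] v(2) c by (meson mult_left_mono order_trans)
    qed (use finite_sphere_at sphere_at_nonempty in auto)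
    then show ?thesis using False 1 by (simp add: sphere_mean_def)
  next
    case (2 r)
    let ?w = "1 / ((real q + 1) * real q ^ (n - 1))"
    have "(?w * (\<Sum>v\<in>sphere_at n. cmod (f v) powr r)) powr (1/r)
          \<le> (?w * (\<Sum>v\<in>sphere_at n. (c * cmod (g v)) powr r)) powr (1/r)"
      using 2 le by (intro powr_mono2 mult_left_mono sum_mono mult_nonneg_nonneg sum_nonneg) auto
    also have "(\<Sum>v\<in>sphere_at n. (c * cmod (g v)) powr r)
        = c powr r * (\<Sum>v\<in>sphere_at n. cmod (g v) powr r)"
      using c by (simp add: powr_mult sum_distrib_left)
    also have "(?w * (c powr r * (\<Sum>v\<in>sphere_at n. cmod (g v) powr r))) powr (1/r)
        = (c powr r * (?w * (\<Sum>v\<in>sphere_at n. cmod (g v) powr r))) powr (1/r)"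
      by (simp only: mult.left_commute)
    also have "\<dots> = c * (?w * (\<Sum>v\<in>sphere_at n. cmod (g v) powr r)) powr (1/r)"
      using c 2 by (subst powr_mult) (auto simp: powr_powr intro!: mult_nonneg_nonneg sum_nonneg)
    finally show ?thesis using False 2 by (simp add: sphere_mean_def)
  qed
qed

lemma sphere_mean_triangle: "M n (\<lambda>v. f v + g v) \<le> M n f + M n g"
proof (cases "n = 0")
  case True
  then show ?thesis by (simp add: sphere_mean_def norm_triangle_ineq)
next
  case False
  show ?thesis
  proof (cases rule: p_cases)
    case 1
    have "Max ((\<lambda>v. cmod (f v + g v)) ` sphere_at n)
        \<le> Max ((\<lambda>v. cmod (f v)) ` sphere_at n) + Max ((\<lambda>v. cmod (g v)) ` sphere_at n)"
    proof (rule Max.boundedI)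
      fix a assume "a \<in> (\<lambda>v. cmod (f v + g v)) ` sphere_at n"
      then obtain v where v: "level E rt v = n" "a = cmod (f v + g v)" by auto
      have "cmod (f v + g v) \<le> cmod (f v) + cmod (g v)" by (rule norm_triangle_ineq)
      also have "\<dots> \<le> Max ((\<lambda>v. cmod (f v)) ` sphere_at n) + Max ((\<lambda>v. cmod (g v)) ` sphere_at n)"
        using v finite_sphere_at by (intro add_mono Max_ge) auto
      finally show "a \<le> Max ((\<lambda>v. cmod (f v)) ` sphere_at n) + Max ((\<lambda>v. cmod (g v)) ` sphere_at n)"
        using v by simp
    qed (use finite_sphere_at sphere_at_nonempty in auto)
    then show ?thesis using False 1 by (simp add: sphere_mean_def)
  next
    case (2 r)
    let ?w = "1 / ((real q + 1) * real q ^ (n - 1))"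
    have "(?w * (\<Sum>v\<in>sphere_at n. cmod (f v + g v) powr r)) powr (1/r)
          \<le> (?w * (\<Sum>v\<in>sphere_at n. (cmod (f v) + cmod (g v)) powr r)) powr (1/r)"
      using 2 by (intro powr_mono2 mult_left_mono sum_mono mult_nonneg_nonneg sum_nonneg norm_triangle_ineq) auto
    also have "\<dots> \<le> (?w * (\<Sum>v\<in>sphere_at n. cmod (f v) powr r)) powr (1/r)
        + (?w * (\<Sum>v\<in>sphere_at n. cmod (g v) powr r)) powr (1/r)"
      using 2 by (intro weighted_Minkowski) auto
    finally show ?thesis using False 2 by (simp add: sphere_mean_def)
  qed
qed

lemma sphere_mean_eq_0D:
  assumes "M n f = 0" and v: "level E rt v = n"
  shows "f v = 0"
proof (cases "n = 0")
  case True
  then show ?thesis using assms sphere_at_0 by (auto simp: sphere_mean_def)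
next
  case False
  show ?thesis
  proof (cases rule: p_cases)
    case 1
    have "cmod (f v) \<le> Max ((\<lambda>v. cmod (f v)) ` sphere_at n)"
      using v finite_sphere_at by (intro Max_ge) auto
    then show ?thesis using assms False 1 by (simp add: sphere_mean_def)
  next
    case (2 r)
    \<comment> \<open>By \<open>q_pos\<close> the weight in front of the sum is nonzero, so the sum
      itself must vanish.\<close>
    have "(\<Sum>v\<in>sphere_at n. cmod (f v) powr r) = 0"
      using assms False 2 q_pos by (simp add: sphere_mean_def)
    then have "cmod (f v) powr r = 0"
      using v finite_sphere_at[of n] by (subst (asm) sum_nonneg_eq_0_iff) auto
    then show ?thesis by simp
  qed
qed

end

subsection \<open>Compact and bounded operators\<close>

locale hardy_operator_space = hardy_tree E q rt p
  for E :: "'v \<Rightarrow> 'v \<Rightarrow> bool" and q rt p +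
  fixes X :: "('v \<Rightarrow> complex) set"
  assumes X: "X = hardy_space E q rt p \<or> X = hardy_space0 E q rt p"
begin

section \<open>The space \<open>X\<close> and its norm\<close>

lemma bdd_above_mean: "f \<in> X \<Longrightarrow> bdd_above (range (\<lambda>n. M n f))"
  using X by (auto simp: hardy_space_def hardy_space0_def)

lemma mean_le_norm: "f \<in> X \<Longrightarrow> M n f \<le> N f"
  unfolding hardy_norm_def by (rule cSUP_upper[OF _ bdd_above_mean]) auto

lemma norm_leI: "(\<And>n. M n f \<le> c) \<Longrightarrow> N f \<le> c"
  unfolding hardy_norm_def by (rule cSUP_least) auto

lemma norm_nonneg: "f \<in> X \<Longrightarrow> 0 \<le> N f"
  using mean_le_norm[of f 0] sphere_mean_nonneg[of 0 f] by linarith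

text \<open>Treats both choices of \<open>X\<close> at once: a bounded majorant of the means gives
  membership in \<open>hardy_space\<close>, and squeezing below a null sequence gives
  \<open>hardy_space0\<close>.\<close>

lemma in_space_if_mean_le:
  assumes le: "\<And>n. M n f \<le> b n" and bdd: "bdd_above (range b)"
    and lim: "X = hardy_space0 E q rt p \<Longrightarrow> b \<longlonglongrightarrow> 0"
  shows "f \<in> X"
proof -
  from bdd obtain B where "\<And>n. b n \<le> B" by (auto simp: bdd_above_def)
  then have *: "bdd_above (range (\<lambda>n. M n f))"
    by (intro bdd_aboveI2[where M = B]) (use le order_trans in blast)
  moreover have "(\<lambda>n. M n f) \<longlonglongrightarrow> 0" if "X = hardy_space0 E q rt p"
    using tendsto_sandwich[of "\<lambda>_. 0" "\<lambda>n. M n f" sequentially b 0] lim[OF that] le sphere_mean_nonneg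
    by auto
  ultimately show ?thesis using X by (auto simp: hardy_space_def hardy_space0_def)
qed

text \<open>Pointwise domination passes to each sphere mean, hence to the supremum. It serves
  negation and the zero function as well as the final estimate of multiplication by the tail of
  \<psi>.\<close>

lemma dominated:
  assumes g: "g \<in> X" and c: "c \<ge> 0" and le: "\<And>v. cmod (f v) \<le> c * cmod (g v)"
  shows "f \<in> X" "N f \<le> c * N g"
proof -
  have mean: "M n f \<le> c * M n g" for n using c le by (rule sphere_mean_scale_mono)
  show "N f \<le> c * N g"
    using mean mean_le_norm[OF g] c by (intro norm_leI) (meson mult_left_mono order_trans)
  show "f \<in> X"
  proof (rule in_space_if_mean_le[OF mean])
    show "bdd_above (range (\<lambda>n. c * M n g))"
      using mean_le_norm[OF g] c by (intro bdd_aboveI2[where M = "c * N g"] mult_left_mono)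
    show "(\<lambda>n. c * M n g) \<longlonglongrightarrow> 0" if "X = hardy_space0 E q rt p"
      using that g by (auto simp: hardy_space0_def intro: tendsto_mult_right_zero)
  qed
qed

lemma add_space:
  assumes f: "f \<in> X" and g: "g \<in> X"
  shows "(\<lambda>v. f v + g v) \<in> X" "N (\<lambda>v. f v + g v) \<le> N f + N g"
proof -
  have bound: "M n f + M n g \<le> N f + N g" for n
    using mean_le_norm[OF f] mean_le_norm[OF g] by (rule add_mono)
  show "N (\<lambda>v. f v + g v) \<le> N f + N g"
    using sphere_mean_triangle bound by (intro norm_leI) (rule order_trans)
  show "(\<lambda>v. f v + g v) \<in> X"
  proof (rule in_space_if_mean_le[OF sphere_mean_triangle])
    show "bdd_above (range (\<lambda>n. M n f + M n g))"
      using bound by (rule bdd_aboveI2)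
    show "(\<lambda>n. M n f + M n g) \<longlonglongrightarrow> 0" if "X = hardy_space0 E q rt p"
      using that f g by (auto simp: hardy_space0_def intro: tendsto_add_zero)
  qed
qed

lemma diff_space:
  assumes f: "f \<in> X" and g: "g \<in> X"
  shows "(\<lambda>v. f v - g v) \<in> X" "N (\<lambda>v. f v - g v) \<le> N f + N g"
  using add_space[OF f dominated(1)[OF g, of 1 "\<lambda>v. - g v"]] dominated(2)[OF g, of 1 "\<lambda>v. - g v"]
  by auto

lemma finite_support_space:
  assumes "finite {v. f v \<noteq> 0}"
  shows "f \<in> X"
proof (rule in_space_if_mean_le[OF order_refl])
  obtain m where m: "\<And>v. f v \<noteq> 0 \<Longrightarrow> level E rt v \<le> m"
    using assms finite_nat_set_iff_bounded_le[of "level E rt ` {v. f v \<noteq> 0}"] by auto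
  \<comment> \<open>Here \<open>f\<close> vanishes on the whole sphere, so comparing
    \<open>f\<close> with itself with factor 0 bounds the mean by 0.\<close>
  have "M n f = 0" if "n > m" for n
    using sphere_mean_scale_mono[of 0 n f f] m that sphere_mean_nonneg[of n f] by force
  then have lim: "(\<lambda>n. M n f) \<longlonglongrightarrow> 0"
    by (intro tendsto_eventually) (auto simp: eventually_at_top_dense)
  then show "bdd_above (range (\<lambda>n. M n f))"
    by (intro bounded_imp_bdd_above convergent_imp_bounded)
  show "(\<lambda>n. M n f) \<longlonglongrightarrow> 0" by (rule lim)
qed

text \<open>On the sphere through \<open>v\<close> the indicator \<open>d\<close> of
  \<open>v\<close> is at most \<open>cmod (f w) / cmod (f v)\<close>. Taking means bounds
  \<open>cmod (f v)\<close> by \<open>M ?n f / M ?n d\<close>, where \<open>M ?n d\<close> is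
  positive by definiteness.\<close>

lemma point_evaluation_bounded: "\<exists>C. \<forall>f\<in>X. cmod (f v) \<le> C * N f"
proof -
  define d :: "'v \<Rightarrow> complex" where "d w = (if w = v then 1 else 0)" for w
  let ?n = "level E rt v"
  have pos: "M ?n d > 0"
    using sphere_mean_eq_0D[of ?n d v] sphere_mean_nonneg[of ?n d] by (force simp: d_def)
  have "cmod (f v) \<le> (1 / M ?n d) * N f" if f: "f \<in> X" for f
  proof (cases "f v = 0")
    case True
    then show ?thesis using pos norm_nonneg[OF f] by simp
  next
    case False
    have "M ?n d \<le> (1 / cmod (f v)) * M ?n f"
      by (rule sphere_mean_scale_mono) (use False in \<open>auto simp: d_def\<close>)
    also have "\<dots> \<le> (1 / cmod (f v)) * N f"
      using mean_le_norm[OF f] by (intro mult_left_mono) auto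
    finally show ?thesis using pos False by (simp add: field_simps)
  qed
  then show ?thesis by blast
qed

lemma zero_space: "(\<lambda>_. 0) \<in> X" "N (\<lambda>_. 0) = 0"
proof -
  show *: "(\<lambda>_. 0) \<in> X" by (rule finite_support_space) simp
  show "N (\<lambda>_. 0) = 0"
    using dominated(2)[OF *, of 0 "\<lambda>_. 0"] norm_nonneg[OF *] by simp
qed

lemma norm_eq_0D: "f \<in> X \<Longrightarrow> N f = 0 \<Longrightarrow> f = (\<lambda>_. 0)"
  using point_evaluation_bounded by fastforce

section \<open>The norm topology and compact multiplication operators\<close>

lemma Metric_space_norm_dist: "Metric_space X (norm_dist X N)"
proof
  fix f g h
  show "0 \<le> norm_dist X N f g"
    using norm_nonneg diff_space(1) by (simp add: norm_dist_def)
  have "N (\<lambda>v. f v - g v) \<le> N (\<lambda>v. g v - f v)" if "f \<in> X" "g \<in> X" for f g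
    using dominated(2)[OF diff_space(1)[OF that(2,1)], of 1] by (simp add: norm_minus_commute)
  then show "norm_dist X N f g = norm_dist X N g f"
    by (auto simp: norm_dist_def intro: antisym)
  show "norm_dist X N f g = 0 \<longleftrightarrow> f = g" if "f \<in> X" "g \<in> X"
    using that norm_eq_0D[OF diff_space(1)[OF that]] zero_space(2)
    by (auto simp: norm_dist_def fun_eq_iff)
  show "norm_dist X N f h \<le> norm_dist X N f g + norm_dist X N g h" if "f \<in> X" "g \<in> X" "h \<in> X"
    using that add_space(2)[OF diff_space(1)[of f g] diff_space(1)[of g h]]
    by (simp add: norm_dist_def)
qed

sublocale metric: Metric_space X "norm_dist X N"
  by (rule Metric_space_norm_dist)

text \<open>
  On functions supported in the finite set \<open>F\<close> the topology of pointwise convergence is at least as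
  fine as the norm topology, so compactness is inherited from Tychonoff's theorem.
\<close>

lemma compactin_finite_support:
  assumes F: "finite F"
  shows "compactin (norm_topology X N) {f. (\<forall>v\<in>F. cmod (f v) \<le> R) \<and> (\<forall>v. v \<notin> F \<longrightarrow> f v = 0)}"
    (is "compactin _ ?B")
proof -
  define S where "S v = (if v \<in> F then cball 0 R else {0 :: complex})" for v
  have B: "?B = (\<Pi>\<^sub>E v\<in>UNIV. S v)"
    by (auto simp: S_def PiE_iff split: if_splits)
  have BX: "?B \<subseteq> X"
  proof
    fix f assume "f \<in> ?B"
    then have "{v. f v \<noteq> 0} \<subseteq> F" by auto
    then show "f \<in> X" using F finite_subset finite_support_space by blast
  qed
  have "compactin (product_topology (\<lambda>_. euclidean) UNIV) ?B"
    unfolding B compactin_PiE by (auto simp: S_def)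
  then have comp: "compactin (top_of_set ?B) ?B"
    by (simp add: compactin_subtopology euclidean_product_topology)
  \<comment> \<open>The indicator of \<open>F\<close> turns a uniform bound on \<open>F\<close> into
    a norm bound: a function supported in \<open>F\<close> with values at most \<delta> in modulus
    has norm at most \<open>\<delta> * N e\<close>.\<close>
  define e :: "'v \<Rightarrow> complex" where "e v = (if v \<in> F then 1 else 0)" for v
  have e: "e \<in> X"
    using F by (intro finite_support_space) (auto simp: e_def)
  have "continuous_map (top_of_set ?B) metric.mtopology id"
    unfolding metric.continuous_map_to_metric
  proof (intro ballI allI impI)
    fix f and \<epsilon> :: real assume f: "f \<in> topspace (top_of_set ?B)" and \<epsilon>: "\<epsilon> > 0"
    \<comment> \<open>Adding 1 keeps the denominator positive when \<open>N e = 0\<close> and makes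
      \<open>\<delta> * N e\<close> strictly smaller than \<epsilon>.\<close>
    define \<delta> where "\<delta> = \<epsilon> / (N e + 1)"
    have \<delta>: "\<delta> > 0" "\<delta> * N e < \<epsilon>"
      using \<epsilon> norm_nonneg[OF e] by (auto simp: \<delta>_def field_simps)
    let ?U = "{g. \<forall>v\<in>F. g v \<in> ball (f v) \<delta>}"
    have "open ?U"
      using product_topology_basis'[OF F, of "\<lambda>v. ball (f v) \<delta>" "\<lambda>v. v"] by simp
    then have op: "openin (top_of_set ?B) (?B \<inter> ?U)"
      by (rule openin_open_Int)
    have "g \<in> metric.mball f \<epsilon>" if g: "g \<in> ?B \<inter> ?U" for g
    proof -
      have "cmod (f v - g v) \<le> \<delta> * cmod (e v)" for v
        using f g by (auto simp: e_def dist_norm less_imp_le)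
      then have "N (\<lambda>v. f v - g v) \<le> \<delta> * N e"
        using \<delta> e by (intro dominated(2)) auto
      then show ?thesis
        using \<delta> f g BX by (auto simp: norm_dist_def)
    qed
    then show "\<exists>U. openin (top_of_set ?B) U \<and> f \<in> U \<and> (\<forall>y\<in>U. id y \<in> metric.mball (id f) \<epsilon>)"
      using op f \<delta> by (intro exI[of _ "?B \<inter> ?U"]) auto
  qed
  from image_compactin[OF comp this] show ?thesis
    by (simp add: norm_topology_def)
qed

text \<open>Bounded point evaluations place the image of the unit ball in a compact set
  \<open>?B\<close> of functions supported where \<phi> is nonzero. As the norm topology is
  Hausdorff, \<open>?B\<close> is closed and contains the closure of the image, which is then
  compact.\<close>

lemma compact_mult_finite_support:
  assumes F: "finite {v. \<phi> v \<noteq> 0}"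
  shows "compact_operator X N (mult_operator \<phi>)"
proof -
  let ?F = "{v. \<phi> v \<noteq> 0}" and ?K = "mult_operator \<phi>"
  obtain C where C: "\<And>v f. f \<in> X \<Longrightarrow> cmod (f v) \<le> C v * N f"
    using point_evaluation_bounded by metis
  \<comment> \<open>One bound valid at all vertices of the support; the absolute values make every
    summand nonnegative, so each is at most the sum.\<close>
  define R where "R = (\<Sum>v\<in>?F. cmod (\<phi> v) * \<bar>C v\<bar>)"
  let ?B = "{f. (\<forall>v\<in>?F. cmod (f v) \<le> R) \<and> (\<forall>v. v \<notin> ?F \<longrightarrow> f v = 0)}"
  have lin: "linear_operator X ?K"
    using F by (auto simp: linear_operator_def mult_operator_def algebra_simps
        intro!: finite_support_space elim: rev_finite_subset)
  have "?K ` {f \<in> X. N f \<le> 1} \<subseteq> ?B"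
  proof (rule image_subsetI)
    fix f assume f: "f \<in> {f \<in> X. N f \<le> 1}"
    have "cmod (\<phi> v * f v) \<le> R" if v: "v \<in> ?F" for v
    proof -
      have "C v * N f \<le> \<bar>C v\<bar> * 1"
        using f norm_nonneg[of f] by (intro mult_mono) auto
      then have "cmod (\<phi> v * f v) \<le> cmod (\<phi> v) * \<bar>C v\<bar>"
        using C[of f v] f by (auto simp: norm_mult intro!: mult_left_mono)
      also have "\<dots> \<le> R"
        unfolding R_def using F v by (intro member_le_sum) auto
      finally show ?thesis .
    qed
    then show "?K f \<in> ?B"
      by (auto simp: mult_operator_def)
  qed
  moreover have "closedin (norm_topology X N) ?B"
    using compactin_finite_support[OF F] metric.Hausdorff_space_mtopology
    by (auto simp: norm_topology_def intro: compactin_imp_closedin)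
  ultimately have "norm_topology X N closure_of (?K ` {f \<in> X. N f \<le> 1}) \<subseteq> ?B"
    by (rule closure_of_minimal)
  with lin show ?thesis
    unfolding compact_operator_def
    using closed_compactin[OF compactin_finite_support[OF F] _ closedin_closure_of] by blast
qed

section \<open>Operator norms and the essential norm\<close>

lemma compact_operator_bounded:
  assumes "compact_operator X N K"
  shows "\<exists>C. \<forall>f\<in>X. N f \<le> 1 \<longrightarrow> N (K f) \<le> C"
proof -
  let ?KB = "K ` {f \<in> X. N f \<le> 1}"
  have KX: "?KB \<subseteq> X"
    using assms by (auto simp: compact_operator_def linear_operator_def)
  then have "?KB \<subseteq> metric.mtopology closure_of ?KB"
    by (intro closure_of_subset) simp
  moreover have "metric.mbounded (metric.mtopology closure_of ?KB)"
    using assms metric.compactin_imp_mbounded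
    by (simp add: compact_operator_def norm_topology_def)
  ultimately have "metric.mbounded ?KB" by (rule metric.mbounded_subset[rotated])
  then obtain C where C: "\<And>f g. f \<in> ?KB \<Longrightarrow> g \<in> ?KB \<Longrightarrow> norm_dist X N f g \<le> C"
    unfolding metric.mbounded_alt by blast
  \<comment> \<open>Metric boundedness of a compact set only controls mutual distances; the image of
    the zero function is the base point that turns them into norms.\<close>
  let ?z = "K (\<lambda>_. 0)"
  have z: "?z \<in> ?KB" using zero_space by auto
  have "N (K f) \<le> C + N ?z" if f: "f \<in> X" "N f \<le> 1" for f
  proof -
    have Kf: "K f \<in> ?KB" using f by blast
    have "N (\<lambda>v. (K f v - ?z v) + ?z v) \<le> N (\<lambda>v. K f v - ?z v) + N ?z"
      using Kf z KX by (intro add_space diff_space(1)) auto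
    moreover have "N (\<lambda>v. K f v - ?z v) \<le> C"
      using C[OF Kf z] Kf z KX unfolding norm_dist_def by (auto split: if_splits)
    ultimately show ?thesis by simp
  qed
  then show ?thesis by blast
qed

lemma bounded_operator_bound:
  assumes "bounded_operator X N A"
  shows "\<exists>C. \<forall>f\<in>X. N f \<le> 1 \<longrightarrow> N (A f) \<le> C"
proof -
  obtain C where C: "\<And>f. f \<in> X \<Longrightarrow> N (A f) \<le> C * N f"
    using assms by (auto simp: bounded_operator_def)
  have "N (A f) \<le> \<bar>C\<bar>" if "f \<in> X" "N f \<le> 1" for f
  proof -
    have "C * N f \<le> \<bar>C\<bar> * 1"
      using that norm_nonneg by (intro mult_mono) auto
    then show ?thesis using C[OF that(1)] by linarith
  qed
  then show ?thesis by blast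
qed

text \<open>The bounds for \<open>A\<close> and \<open>K\<close> make the real supremum over the
  unit ball a genuine one, so it is at least the nonnegative value at the zero function.\<close>

lemma operator_norm_diff_nonneg:
  assumes A: "bounded_operator X N A" and K: "compact_operator X N K"
  shows "0 \<le> operator_norm X N (\<lambda>f v. A f v - K f v)"
proof -
  have AK: "A f \<in> X" "K f \<in> X" if "f \<in> X" for f
    using A K that by (auto simp: bounded_operator_def compact_operator_def linear_operator_def)
  obtain a k where "\<And>f. f \<in> X \<Longrightarrow> N f \<le> 1 \<Longrightarrow> N (A f) \<le> a"
    and "\<And>f. f \<in> X \<Longrightarrow> N f \<le> 1 \<Longrightarrow> N (K f) \<le> k"
    using bounded_operator_bound[OF A] compact_operator_bounded[OF K] by metis
  then have "N (\<lambda>v. A f v - K f v) \<le> a + k" if "f \<in> X" "N f \<le> 1" for f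
    using diff_space(2)[OF AK[OF that(1)]] that by (meson add_mono order_trans)
  then have bdd: "bdd_above ((\<lambda>f. N (\<lambda>v. A f v - K f v)) ` {f \<in> X. N f \<le> 1})"
    by (intro bdd_aboveI2[where M = "a + k"]) auto
  have "0 \<le> N (\<lambda>v. A (\<lambda>_. 0) v - K (\<lambda>_. 0) v)"
    using AK zero_space(1) by (intro norm_nonneg diff_space(1)) auto
  also have "\<dots> \<le> operator_norm X N (\<lambda>f v. A f v - K f v)"
    unfolding operator_norm_def using zero_space by (intro cSUP_upper bdd) auto
  finally show ?thesis .
qed

lemma essential_norm_le:
  assumes A: "bounded_operator X N A" and K: "compact_operator X N K"
  shows "essential_norm X N A \<le> operator_norm X N (\<lambda>f v. A f v - K f v)"
  unfolding essential_norm_def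
  using operator_norm_diff_nonneg[OF A] K by (intro cINF_lower bdd_belowI2[where m = 0]) auto

lemma essential_norm_mult_le_tail:
  assumes A: "bounded_operator X N (mult_operator \<psi>)"
  shows "ereal (essential_norm X N (mult_operator \<psi>))
           \<le> (SUP v\<in>{v. n \<le> level E rt v}. ereal (cmod (\<psi> v)))" (is "_ \<le> ?s")
proof -
  obtain u where u: "level E rt u = n" using sphere_at_nonempty by blast
  have le: "ereal (cmod (\<psi> v)) \<le> ?s" if "n \<le> level E rt v" for v
    using that by (intro SUP_upper) auto
  have nonneg: "0 \<le> ?s"
    using le[of u] u by (auto intro: order_trans[of 0 "ereal (cmod (\<psi> u))"])
  show ?thesis
  \<comment> \<open>Only a finite supremum needs work: plus infinity bounds everything, and minus
    infinity is excluded by the vertex \<open>u\<close> at level \<open>n\<close>.\<close>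
  proof (cases ?s)
    case (real L)
    have L: "0 \<le> L" "\<And>v. n \<le> level E rt v \<Longrightarrow> cmod (\<psi> v) \<le> L"
      using nonneg le real by auto
    define \<phi> where "\<phi> v = (if level E rt v < n then \<psi> v else 0)" for v
    have "finite {v. \<phi> v \<noteq> 0}"
      by (rule finite_subset[OF _ finite_ball_at[of n]]) (auto simp: \<phi>_def)
    then have "essential_norm X N (mult_operator \<psi>)
        \<le> operator_norm X N (\<lambda>f v. mult_operator \<psi> f v - mult_operator \<phi> f v)"
      by (intro essential_norm_le A compact_mult_finite_support)
    also have "\<dots> \<le> L"
      unfolding operator_norm_def
    proof (rule cSUP_least)
      show "{f \<in> X. N f \<le> 1} \<noteq> {}" using zero_space by force
      fix f assume f: "f \<in> {f \<in> X. N f \<le> 1}"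
      \<comment> \<open>Below level \<open>n\<close> the difference is 0; from level
        \<open>n\<close> on it is \<open>\<psi> v * f v\<close>, with \<open>\<psi> v\<close>
        bounded by \<open>L\<close>.\<close>
      have "cmod (mult_operator \<psi> f v - mult_operator \<phi> f v) \<le> L * cmod (f v)" for v
        using L by (auto simp: mult_operator_def \<phi>_def norm_mult intro!: mult_right_mono)
      then have "N (\<lambda>v. mult_operator \<psi> f v - mult_operator \<phi> f v) \<le> L * N f"
        using f L by (intro dominated(2)) auto
      also have "\<dots> \<le> L * 1" using f L by (intro mult_left_mono) auto
      finally show "N (\<lambda>v. mult_operator \<psi> f v - mult_operator \<phi> f v) \<le> L" by simp
    qed
    finally show ?thesis using real by simp
  qed (use nonneg in auto)
qed

end

section \<open>The limit superior as a limit of tail suprema\<close>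

lemma (in rooted_tree) SUP_sphere_mean_infinity:
  "(SUP m\<in>{n..}. ereal (sphere_mean E q rt \<infinity> m f)) = (SUP v\<in>{v. n \<le> level E rt v}. ereal (cmod (f v)))"
proof -
  \<comment> \<open>The separate clause for level 0 agrees with the maximum because that sphere is
    \<open>{rt}\<close>.\<close>
  have mean: "sphere_mean E q rt \<infinity> m f = Max ((\<lambda>v. cmod (f v)) ` sphere_at m)" for m
    by (cases "m = 0") (simp_all add: sphere_mean_def sphere_at_0)
  show ?thesis
  proof (intro antisym SUP_least)
    fix m assume "m \<in> {n..}"
    have "Max ((\<lambda>v. cmod (f v)) ` sphere_at m) \<in> (\<lambda>v. cmod (f v)) ` sphere_at m"
      using finite_sphere_at sphere_at_nonempty by (intro Max_in) auto
    then obtain v where "level E rt v = m" "sphere_mean E q rt \<infinity> m f = cmod (f v)"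
      unfolding mean by auto
    then show "ereal (sphere_mean E q rt \<infinity> m f) \<le> (SUP v\<in>{v. n \<le> level E rt v}. ereal (cmod (f v)))"
      using \<open>m \<in> {n..}\<close> by (auto intro: SUP_upper)
  next
    fix v assume v: "v \<in> {v. n \<le> level E rt v}"
    have "cmod (f v) \<le> sphere_mean E q rt \<infinity> (level E rt v) f"
      unfolding mean using finite_sphere_at by (intro Max_ge) auto
    then show "ereal (cmod (f v)) \<le> (SUP m\<in>{n..}. ereal (sphere_mean E q rt \<infinity> m f))"
      using v by (intro SUP_upper2[of "level E rt v"]) auto
  qed
qed

theorem theorem9:
  fixes E :: "'v \<Rightarrow> 'v \<Rightarrow> bool"
    and rt :: 'v
    and q :: nat
    and p :: ereal
    and X :: "('v \<Rightarrow> complex) set"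
    and \<psi> :: "'v \<Rightarrow> complex"
  assumes "q \<ge> 1"
    and "homogeneous_tree E (q + 1)"
    and "infinite (UNIV :: 'v set)"
    and "1 \<le> p"
    and "X = hardy_space E q rt p \<or> X = hardy_space0 E q rt p"
    and "bounded_operator X (hardy_norm E q rt p) (mult_operator \<psi>)"
  shows "ereal (essential_norm X (hardy_norm E q rt p) (mult_operator \<psi>))
           \<le> limsup (\<lambda>n. ereal (sphere_mean E q rt \<infinity> n \<psi>)) \<and>
         (\<lambda>n. SUP v\<in>{v. n \<le> level E rt v}. ereal (cmod (\<psi> v)))
           \<longlonglongrightarrow> limsup (\<lambda>n. ereal (sphere_mean E q rt \<infinity> n \<psi>))"
proof -
  interpret hardy_operator_space E q rt p X
    using assms by unfold_locales auto
  let ?s = "\<lambda>n. SUP v\<in>{v. n \<le> level E rt v}. ereal (cmod (\<psi> v))"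
  have limsup: "limsup (\<lambda>n. ereal (sphere_mean E q rt \<infinity> n \<psi>)) = (INF n. ?s n)"
    by (simp add: limsup_INF_SUP SUP_sphere_mean_infinity)
  \<comment> \<open>The index sets shrink as \<open>n\<close> grows, so the tail suprema decrease
    and converge to their infimum, which is the limit superior.\<close>
  have "decseq ?s"
    by (auto simp: decseq_def intro!: SUP_subset_mono)
  then have "?s \<longlonglongrightarrow> (INF n. ?s n)" by (rule LIMSEQ_INF)
  moreover have "ereal (essential_norm X N (mult_operator \<psi>)) \<le> (INF n. ?s n)"
    by (intro INF_greatest essential_norm_mult_le_tail assms)
  ultimately show ?thesis by (simp add: limsup)
qed

end
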